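(* Let $I\subset\mathbb{R}$ be an open interval, let $a,b\in I$ with $a<b$, and let $f:I\to\mathbb{R}$ be a twice differentiable function. Let $\gamma,\Gamma$ be real numbers such that $\gamma\le f''(t)\le\Gamma$ for all $t\in[a,b]$. Then $$\left|\frac{b-a}{8}\left[f(a)+3f\left(\frac{2a+b}{3}\right)+3f\left(\frac{a+2b}{3}\right)+f(b)\right]-\int_a^b f(t)\,dt\right|\le\frac{\Gamma-\gamma}{384}(b-a)^3.$$
   Context: No continuity of $f''$ is assumed. *)

theory Defs
  imports "HOL-Analysis.Analysis"
begin

end

theory Submission
  imports Defs
begin

text \<open>
  Integrating by parts twice, the error of the rule is the integral of \<open>K * f''\<close>, where the Peano
  kernel \<open>K\<close> is quadratic with second derivative \<open>-1\<close> on each third of the interval, and the integral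
  of \<open>K\<close> vanishes since the rule is exact for quadratics. So \<open>f''\<close> may be replaced by
  \<open>f'' - (\<gamma> + \<Gamma>) / 2\<close>, which is at most \<open>(\<Gamma> - \<gamma>) / 2\<close> in absolute value, while the integral of \<open>\<bar>K\<bar>\<close>
  is \<open>(b - a) ^ 3 / 192\<close>. As \<open>f''\<close> need not be continuous, the integrals are Henstock-Kurzweil ones:
  \<open>K * f'' + f\<close> is the derivative of \<open>K * f' - K' * f\<close>, hence integrable.
\<close>

text \<open>These are the quadratics with second derivative -1 that vanish at \<open>c\<close>: the
  slope there is \<open>\<beta>\<close> and the other zero is
  \<open>c + 2 * \<beta>\<close>.\<close>

definition peano_kernel :: "real \<Rightarrow> real \<Rightarrow> real \<Rightarrow> real" where
  "peano_kernel \<beta> c t = \<beta> * (t - c) - (t - c)\<^sup>2 / 2"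

definition peano_kernel_primitive :: "real \<Rightarrow> real \<Rightarrow> real \<Rightarrow> real" where
  "peano_kernel_primitive \<beta> c t = \<beta> * (t - c)\<^sup>2 / 2 - (t - c) ^ 3 / 6"

definition peano_boundary ::
    "(real \<Rightarrow> real) \<Rightarrow> (real \<Rightarrow> real) \<Rightarrow> real \<Rightarrow> real \<Rightarrow> real \<Rightarrow> real" where
  "peano_boundary f f' \<beta> c t = peano_kernel \<beta> c t * f' t - (\<beta> - (t - c)) * f t"

text \<open>The kernel keeps the sign \<open>s\<close> on the piece, so its absolute value is
  \<open>s\<close> times itself and integrates to \<open>s * (P v - P u)\<close>. The term with
  \<open>(\<gamma> + \<Gamma>) / 2\<close> stays in the statement because the kernel integrates to
  zero only over the whole interval, not over each piece.\<close>

lemma peano_kernel_bound: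
  fixes f f' f'' :: "real \<Rightarrow> real" and s :: real
  assumes "u \<le> v"
    and f': "\<And>t. t \<in> {u..v} \<Longrightarrow> (f has_real_derivative f' t) (at t)"
    and f'': "\<And>t. t \<in> {u..v} \<Longrightarrow> (f' has_real_derivative f'' t) (at t)"
    and bounds: "\<And>t. t \<in> {u..v} \<Longrightarrow> \<gamma> \<le> f'' t \<and> f'' t \<le> \<Gamma>"
    and s: "\<bar>s\<bar> = 1"
    and sign: "\<And>t. t \<in> {u..v} \<Longrightarrow> 0 \<le> s * peano_kernel \<beta> c t"
  defines "G \<equiv> peano_boundary f f' \<beta> c" and "P \<equiv> peano_kernel_primitive \<beta> c"
  shows "\<bar>G v - G u - integral {u..v} f - (\<gamma> + \<Gamma>) / 2 * (P v - P u)\<bar>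
           \<le> (\<Gamma> - \<gamma>) / 2 * (s * (P v - P u))"
proof -
  let ?K = "peano_kernel \<beta> c"
  have G: "((\<lambda>t. ?K t * f'' t + f t) has_integral G v - G u) {u..v}"
    by (rule fundamental_theorem_of_calculus[OF \<open>u \<le> v\<close>])
       (auto simp: G_def peano_boundary_def peano_kernel_def power2_eq_square field_simps
             simp flip: has_real_derivative_iff_has_vector_derivative
             intro!: derivative_eq_intros DERIV_subset[OF f'] DERIV_subset[OF f''])
  have P: "(?K has_integral P v - P u) {u..v}"
    by (rule fundamental_theorem_of_calculus[OF \<open>u \<le> v\<close>])
       (auto simp: P_def peano_kernel_primitive_def peano_kernel_def power2_eq_square field_simps
             simp flip: has_real_derivative_iff_has_vector_derivative
             intro!: derivative_eq_intros)
  have "continuous_on {u..v} f"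
    using f' by (meson DERIV_isCont continuous_at_imp_continuous_on)
  then have f: "(f has_integral integral {u..v} f) {u..v}"
    by (simp add: integrable_continuous_real integrable_integral)
  define D where "D = G v - G u - integral {u..v} f - (\<gamma> + \<Gamma>) / 2 * (P v - P u)"
  have D: "((\<lambda>t. ?K t * (f'' t - (\<gamma> + \<Gamma>) / 2)) has_integral D) {u..v}"
    using has_integral_diff[OF has_integral_diff[OF G f] has_integral_mult_right[OF P, of "(\<gamma> + \<Gamma>) / 2"]]
    unfolding D_def by (simp add: algebra_simps)
  have B: "((\<lambda>t. (\<Gamma> - \<gamma>) / 2 * (s * ?K t)) has_integral (\<Gamma> - \<gamma>) / 2 * (s * (P v - P u))) {u..v}"
    by (intro has_integral_mult_right P)
  have bound: "\<bar>?K t * (f'' t - (\<gamma> + \<Gamma>) / 2)\<bar> \<le> (\<Gamma> - \<gamma>) / 2 * (s * ?K t)" if "t \<in> {u..v}" for t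
  proof -
    have "\<bar>?K t\<bar> = s * ?K t"
      using sign[OF that] s by (metis abs_mult abs_of_nonneg mult_1)
    moreover have "\<bar>f'' t - (\<gamma> + \<Gamma>) / 2\<bar> \<le> (\<Gamma> - \<gamma>) / 2"
      using bounds[OF that] by (simp add: abs_if field_simps)
    ultimately show ?thesis
      using sign[OF that] by (metis abs_mult mult.commute mult_left_mono)
  qed
  \<comment> \<open>Comparing the integrand and its negative with the majorant separately avoids
    having to show that its absolute value is integrable.\<close>
  have "D \<le> (\<Gamma> - \<gamma>) / 2 * (s * (P v - P u))"
    using abs_le_D1[OF bound] by (rule has_integral_le[OF D B])
  moreover have "- D \<le> (\<Gamma> - \<gamma>) / 2 * (s * (P v - P u))"
    using abs_le_D2[OF bound] by (rule has_integral_le[OF has_integral_neg[OF D] B])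
  ultimately show ?thesis
    unfolding D_def by linarith
qed

theorem theorem6:
  fixes f :: "real \<Rightarrow> real" and I :: "real set" and a b \<gamma> \<Gamma> :: real
  assumes "open I" and "is_interval I"
    and "a \<in> I" and "b \<in> I" and "a < b"
    and "f differentiable_on I" and "deriv f differentiable_on I"
    and "\<And>t. t \<in> {a..b} \<Longrightarrow> \<gamma> \<le> deriv (deriv f) t \<and> deriv (deriv f) t \<le> \<Gamma>"
  shows "\<bar>(b - a) / 8 * (f a + 3 * f ((2 * a + b) / 3) + 3 * f ((a + 2 * b) / 3) + f b)
           - integral {a..b} f\<bar>
         \<le> (\<Gamma> - \<gamma>) / 384 * (b - a) ^ 3"
proof -
  have deriv: "(g has_real_derivative deriv g t) (at t)"
    if "g differentiable_on I" "t \<in> {a..b}" for g :: "real \<Rightarrow> real" and t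
  proof -
    have "t \<in> I"
      using assms that(2) by (meson atLeastAtMost_iff mem_is_interval_1_I)
    then have "g differentiable at t"
      using that(1) \<open>open I\<close> by (metis at_within_open differentiable_on_def)
    then show ?thesis
      by (simp add: DERIV_deriv_iff_real_differentiable)
  qed
  note f' = deriv[OF \<open>f differentiable_on I\<close>]
  note f'' = deriv[OF \<open>deriv f differentiable_on I\<close>]
  define h where "h = b - a"
  have b: "b = a + h" and h: "h > 0"
    using \<open>a < b\<close> by (auto simp: h_def)
  let ?G = "peano_boundary f (deriv f)"
  let ?P = "peano_kernel_primitive"
  have piece: "\<bar>?G \<beta> c v - ?G \<beta> c u - integral {u..v} f - (\<gamma> + \<Gamma>) / 2 * (?P \<beta> c v - ?P \<beta> c u)\<bar>
      \<le> (\<Gamma> - \<gamma>) / 2 * (s * (?P \<beta> c v - ?P \<beta> c u))"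
    if "a \<le> u" "u \<le> v" "v \<le> b" "\<bar>s\<bar> = 1"
      "\<And>t. t \<in> {u..v} \<Longrightarrow> 0 \<le> s * peano_kernel \<beta> c t" for u v \<beta> c s
    using that by (intro peano_kernel_bound[where f'' = "deriv (deriv f)"] f' f'' assms) auto
  \<comment> \<open>The nodes \<open>x\<^sub>1\<close> and \<open>x\<^sub>2\<close> separate the
    three quadratics of the kernel; at \<open>p\<^sub>1\<close> and \<open>p\<^sub>2\<close>, the
    second zeros of the outer two, it changes sign. This gives five pieces of constant sign.\<close>
  define p\<^sub>1 x\<^sub>1 m x\<^sub>2 p\<^sub>2
    where "p\<^sub>1 = a + h / 4" and "x\<^sub>1 = a + h / 3" and "m = a + h / 2"
      and "x\<^sub>2 = a + 2 * h / 3" and "p\<^sub>2 = a + 3 * h / 4"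
  note points = p\<^sub>1_def x\<^sub>1_def m_def x\<^sub>2_def p\<^sub>2_def b
  have left: "peano_kernel (h / 8) a t = (t - a) * (p\<^sub>1 - t) / 2"
    and right: "peano_kernel (-(h/8)) b t = (b - t) * (t - p\<^sub>2) / 2" for t
    by (simp_all add: peano_kernel_def points power2_eq_square field_simps)
  \<comment> \<open>The slope \<open>h / 8\<close> of the kernel at \<open>a\<close> produces the
    weight of \<open>f a\<close>; the right third mirrors the left one. The middle quadratic has its
    double zero at \<open>m\<close>, by symmetry.\<close>
  have 1: "\<bar>?G (h/8) a p\<^sub>1 - ?G (h/8) a a - integral {a..p\<^sub>1} f
        - (\<gamma> + \<Gamma>) / 2 * (?P (h/8) a p\<^sub>1 - ?P (h/8) a a)\<bar>
      \<le> (\<Gamma> - \<gamma>) / 2 * (1 * (?P (h/8) a p\<^sub>1 - ?P (h/8) a a))"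
    using h by (intro piece) (auto simp: left, auto simp: points)
  have 2: "\<bar>?G (h/8) a x\<^sub>1 - ?G (h/8) a p\<^sub>1 - integral {p\<^sub>1..x\<^sub>1} f
        - (\<gamma> + \<Gamma>) / 2 * (?P (h/8) a x\<^sub>1 - ?P (h/8) a p\<^sub>1)\<bar>
      \<le> (\<Gamma> - \<gamma>) / 2 * (- 1 * (?P (h/8) a x\<^sub>1 - ?P (h/8) a p\<^sub>1))"
    using h by (intro piece) (auto simp: left mult_le_0_iff, auto simp: points)
  have 3: "\<bar>?G 0 m x\<^sub>2 - ?G 0 m x\<^sub>1 - integral {x\<^sub>1..x\<^sub>2} f
        - (\<gamma> + \<Gamma>) / 2 * (?P 0 m x\<^sub>2 - ?P 0 m x\<^sub>1)\<bar>
      \<le> (\<Gamma> - \<gamma>) / 2 * (- 1 * (?P 0 m x\<^sub>2 - ?P 0 m x\<^sub>1))"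
    using h by (intro piece) (auto simp: peano_kernel_def, auto simp: points)
  have 4: "\<bar>?G (-(h/8)) b p\<^sub>2 - ?G (-(h/8)) b x\<^sub>2 - integral {x\<^sub>2..p\<^sub>2} f
        - (\<gamma> + \<Gamma>) / 2 * (?P (-(h/8)) b p\<^sub>2 - ?P (-(h/8)) b x\<^sub>2)\<bar>
      \<le> (\<Gamma> - \<gamma>) / 2 * (- 1 * (?P (-(h/8)) b p\<^sub>2 - ?P (-(h/8)) b x\<^sub>2))"
    using h by (intro piece) (auto simp: right mult_le_0_iff, auto simp: points)
  have 5: "\<bar>?G (-(h/8)) b b - ?G (-(h/8)) b p\<^sub>2 - integral {p\<^sub>2..b} f
        - (\<gamma> + \<Gamma>) / 2 * (?P (-(h/8)) b b - ?P (-(h/8)) b p\<^sub>2)\<bar>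
      \<le> (\<Gamma> - \<gamma>) / 2 * (1 * (?P (-(h/8)) b b - ?P (-(h/8)) b p\<^sub>2))"
    using h by (intro piece) (auto simp: right, auto simp: points)
  have "continuous_on {a..b} f"
    using f' by (meson DERIV_isCont continuous_at_imp_continuous_on)
  then have split: "integral {a..v} f = integral {a..u} f + integral {u..v} f"
    if "a \<le> u" "u \<le> v" "v \<le> b" for u v
    using that
    by (intro Henstock_Kurzweil_Integration.integral_combine[symmetric] integrable_continuous_real)
       (auto elim: continuous_on_subset)
  have int: "integral {a..b} f = integral {a..p\<^sub>1} f + integral {p\<^sub>1..x\<^sub>1} f + integral {x\<^sub>1..x\<^sub>2} f
      + integral {x\<^sub>2..p\<^sub>2} f + integral {p\<^sub>2..b} f"
    using h split[of p\<^sub>1 x\<^sub>1] split[of x\<^sub>1 x\<^sub>2] split[of x\<^sub>2 p\<^sub>2] split[of p\<^sub>2 b]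
    by (simp add: points)
  \<comment> \<open>At both inner nodes the adjacent quadratics take the same value
    \<open>- h\<^sup>2 / 72\<close>, so the terms in \<open>deriv f\<close> cancel. The slope jumps
    there by \<open>3 * h / 8\<close>, from \<open>- 5 * h / 24\<close> to \<open>h / 6\<close> at
    \<open>x\<^sub>1\<close>, which is the weight of an inner node. At \<open>a\<close> and
    \<open>b\<close> the kernel vanishes.\<close>
  have G: "(?G (h/8) a x\<^sub>1 - ?G (h/8) a a) + (?G 0 m x\<^sub>2 - ?G 0 m x\<^sub>1) + (?G (-(h/8)) b b - ?G (-(h/8)) b x\<^sub>2)
      = h / 8 * (f a + 3 * f x\<^sub>1 + 3 * f x\<^sub>2 + f b)"
    unfolding peano_boundary_def peano_kernel_def points by (simp add: power2_eq_square field_simps)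
  \<comment> \<open>The five values sum to 0, and their absolute values to
    \<open>h ^ 3 / 192\<close>.\<close>
  have P: "?P (h/8) a p\<^sub>1 - ?P (h/8) a a = 1 / 768 * h ^ 3"
    "?P (h/8) a x\<^sub>1 - ?P (h/8) a p\<^sub>1 = - 11 / 20736 * h ^ 3"
    "?P 0 m x\<^sub>2 - ?P 0 m x\<^sub>1 = - 1 / 648 * h ^ 3"
    "?P (-(h/8)) b p\<^sub>2 - ?P (-(h/8)) b x\<^sub>2 = - 11 / 20736 * h ^ 3"
    "?P (-(h/8)) b b - ?P (-(h/8)) b p\<^sub>2 = 1 / 768 * h ^ 3"
    by (simp_all add: peano_kernel_primitive_def points power2_eq_square power3_eq_cube field_simps)
  \<comment> \<open>Naming these products makes the five estimates linear in \<open>\<sigma>\<close>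
    and \<open>\<delta>\<close>. In their sum \<open>\<sigma>\<close> cancels and
    \<open>\<delta>\<close> gets the coefficient 1/192.\<close>
  define \<sigma> \<delta> where "\<sigma> = (\<gamma> + \<Gamma>) / 2 * h ^ 3" and "\<delta> = (\<Gamma> - \<gamma>) / 2 * h ^ 3"
  have scale: "(\<gamma> + \<Gamma>) / 2 * (k * h ^ 3) = k * \<sigma>"
    "(\<Gamma> - \<gamma>) / 2 * (s * (k * h ^ 3)) = s * k * \<delta>" for k s
    by (simp_all add: \<sigma>_def \<delta>_def)
  define E where "E = h / 8 * (f a + 3 * f x\<^sub>1 + 3 * f x\<^sub>2 + f b) - integral {a..b} f"
  have "\<bar>E\<bar> \<le> \<delta> / 192"
    using 1 2 3 4 5 unfolding E_def int G[symmetric] P scale by linarith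
  moreover have "x\<^sub>1 = (2 * a + b) / 3" "x\<^sub>2 = (a + 2 * b) / 3"
    by (simp_all add: points field_simps)
  ultimately show ?thesis
    by (simp add: E_def \<delta>_def h_def)
qed

end
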